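(* There exist a finite connected simple graph $G$ and an edge $e\in E(G)$ such that $G-e$ is connected and $\mathrm{col}_{\mathrm{cg}}(G-e)>\mathrm{col}_{\mathrm{cg}}(G)$, where $\mathrm{col}_{\mathrm{cg}}$ denotes the connected game colouring number.
   Context: $G-e$ denotes the graph obtained from $G$ by deleting the edge $e$ (keeping all vertices). The connected marking game on a finite connected simple graph $G$: two players, Maker and Breaker, alternately mark previously unmarked vertices of $G$, with Maker moving first, until all vertices are marked. After the first move, a vertex may only be marked (by either player) if it is adjacent to a previously marked vertex. The connected game colouring number $\mathrm{col}_{\mathrm{cg}}(G)$ is the least integer $k$ for which Maker has a strategy guaranteeing that every vertex, at the moment it is marked, has at most $k-1$ already-marked neighbours. *)

theory Defs
  imports "Graph_Theory.Digraph_Component"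
begin

text \<open>
  A finite simple graph is a \<open>pair_graph\<close>: a finite vertex set with an irreflexive,
  symmetric adjacency relation \<open>parcs\<close>. The undirected edge \<open>uv\<close> is thus the pair of
  arcs \<open>(u,v)\<close>, \<open>(v,u)\<close>, and deleting it removes both of them.
\<close>

definition delete_edge :: "'a pair_pre_digraph \<Rightarrow> 'a \<Rightarrow> 'a \<Rightarrow> 'a pair_pre_digraph" where
  "delete_edge G u v = G\<lparr>parcs := parcs G - {(u, v), (v, u)}\<rparr>"

text \<open>
  A position of the connected marking game is the list of the vertices marked so far, in the
  order of marking. Maker moves first, hence is to move exactly at positions of even length.
\<close>

definition legal_move :: "'a pair_pre_digraph \<Rightarrow> 'a list \<Rightarrow> 'a \<Rightarrow> bool" where
  "legal_move G p v \<longleftrightarrow>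
     v \<in> pverts G \<and> v \<notin> set p \<and> (p = [] \<or> (\<exists>u\<in>set p. (u, v) \<in> parcs G))"

inductive consistent :: "'a pair_pre_digraph \<Rightarrow> ('a list \<Rightarrow> 'a) \<Rightarrow> 'a list \<Rightarrow> bool"
  for G :: "'a pair_pre_digraph" and \<sigma> :: "'a list \<Rightarrow> 'a" where
  start: "consistent G \<sigma> []"
| maker: "consistent G \<sigma> p \<Longrightarrow> even (length p) \<Longrightarrow> legal_move G p (\<sigma> p)
    \<Longrightarrow> consistent G \<sigma> (p @ [\<sigma> p])"
| breaker: "consistent G \<sigma> p \<Longrightarrow> odd (length p) \<Longrightarrow> legal_move G p v
    \<Longrightarrow> consistent G \<sigma> (p @ [v])"

definition maker_strategy :: "'a pair_pre_digraph \<Rightarrow> ('a list \<Rightarrow> 'a) \<Rightarrow> bool" where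
  "maker_strategy G \<sigma> \<longleftrightarrow>
     (\<forall>p. consistent G \<sigma> p \<and> even (length p) \<and> set p \<noteq> pverts G \<longrightarrow> legal_move G p (\<sigma> p))"

definition back_degree :: "'a pair_pre_digraph \<Rightarrow> 'a list \<Rightarrow> 'a \<Rightarrow> nat" where
  "back_degree G p v = card {u \<in> set p. (u, v) \<in> parcs G}"

text \<open>
  ``At most \<open>k - 1\<close> marked neighbours'' is written with \<open>< k\<close>, because subtraction on \<open>nat\<close>
  truncates at 0: the one-vertex graph has number 1, not 0.
\<close>

definition guarantees :: "'a pair_pre_digraph \<Rightarrow> ('a list \<Rightarrow> 'a) \<Rightarrow> nat \<Rightarrow> bool" where
  "guarantees G \<sigma> k \<longleftrightarrow> (\<forall>p v. consistent G \<sigma> (p @ [v]) \<longrightarrow> back_degree G p v < k)"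

definition col_cg :: "'a pair_pre_digraph \<Rightarrow> nat" where
  "col_cg G = (LEAST k. \<exists>\<sigma>. maker_strategy G \<sigma> \<and> guarantees G \<sigma> k)"

text \<open>
  On a finite connected graph the game never gets stuck, so the minimum in \<open>col_cg\<close> is attained.
\<close>

lemma consistent_subset: "consistent G \<sigma> p \<Longrightarrow> set p \<subseteq> pverts G"
  by (induction rule: consistent.induct) (auto simp: legal_move_def)

lemma exists_legal_move:
  assumes G: "pair_graph G" and conn: "Digraph_Component.connected (with_proj G)"
    and p: "set p \<subseteq> pverts G" "set p \<noteq> pverts G"
  shows "\<exists>v. legal_move G p v"
proof (cases "p = []")
  case True
  then show ?thesis using p by (auto simp: legal_move_def)
next
  case False
  interpret pair_graph G by (rule G)
  obtain w where w: "w \<in> pverts G" "w \<notin> set p" using p by auto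
  obtain a where a: "a \<in> set p" using False by (cases p) auto
  have sc: "a \<rightarrow>\<^sup>*\<^bsub>with_proj (mk_symmetric (with_proj G))\<^esub> w"
    using conn a w p(1)
    by (auto simp: Digraph_Component.connected_def strongly_connected_def mk_symmetric_def)
  have arcs: "parcs (mk_symmetric (with_proj G)) = parcs G"
    using arcs_symmetric by (auto simp: mk_symmetric_def)
  have "(a, w) \<in> rtrancl_on (verts (with_proj (mk_symmetric (with_proj G)))) (parcs G)"
    using sc arcs by (simp add: reachable_def)
  then have "(a, w) \<in> (parcs G)\<^sup>*"
    by (rule rtrancl_on_rtranclI)
  then have "w \<in> set p \<or> (\<exists>x y. x \<in> set p \<and> y \<notin> set p \<and> (x, y) \<in> parcs G)"
    by (induction rule: rtrancl_induct) (use a in auto)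
  then obtain x y where "x \<in> set p" "y \<notin> set p" "(x, y) \<in> parcs G" using w by auto
  then show ?thesis using in_arcsD2 by (auto simp: legal_move_def)
qed

lemma col_cg_attained:
  assumes G: "pair_graph G" and conn: "Digraph_Component.connected (with_proj G)"
  shows "\<exists>\<sigma>. maker_strategy G \<sigma> \<and> guarantees G \<sigma> (col_cg G)"
proof -
  interpret pair_graph G by (rule G)
  define \<sigma> where "\<sigma> p = (SOME v. legal_move G p v)" for p
  have "maker_strategy G \<sigma>"
    unfolding maker_strategy_def \<sigma>_def
    by (metis G conn consistent_subset exists_legal_move someI_ex)
  moreover have "guarantees G \<sigma> (Suc (card (pverts G)))"
    unfolding guarantees_def back_degree_def
  proof (intro allI impI)
    fix p v assume "consistent G \<sigma> (p @ [v])"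
    then have "{u \<in> set p. (u, v) \<in> parcs G} \<subseteq> pverts G"
      using consistent_subset by fastforce
    then show "card {u \<in> set p. (u, v) \<in> parcs G} < Suc (card (pverts G))"
      using card_mono[OF pair_finite_verts] by (simp add: less_Suc_eq_le)
  qed
  ultimately have "\<exists>k \<sigma>. maker_strategy G \<sigma> \<and> guarantees G \<sigma> k" by blast
  then show ?thesis unfolding col_cg_def by (rule LeastI_ex)
qed

end

theory Submission
  imports Defs
begin

text \<open>
  Deleting an edge can take away a move that Maker relies on. The witness has the vertices
  \<open>a, b, c, x, y, m, p, q\<close>: both of \<open>x, y\<close> are joined to all of \<open>a, b, c\<close>, and there are
  three further vertices of degree 2, with \<open>m\<close> joined to \<open>a, b\<close>, \<open>p\<close> joined to \<open>c, x\<close> and \<open>q\<close>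
  joined to \<open>c, y\<close>. The deleted edge is \<open>cp\<close>. Both graphs are compared with the value 3, so what
  matters is whether some vertex is marked after three of its neighbours.

  With the edge \<open>cp\<close>, Maker opens with \<open>c\<close> and then plays a pairing strategy, answering each move of
  Breaker in one of the pairs \<open>ab\<close>, \<open>xy\<close>, \<open>pq\<close> by the other vertex of that pair. The answers are
  always available, because \<open>x, y, p, q\<close> are all neighbours of \<open>c\<close> and both \<open>a, b\<close> are neighbours
  of \<open>x\<close>. None of \<open>a, b, m\<close> is within reach until \<open>x\<close> or \<open>y\<close> is marked, and then Maker marks the
  other one at once. Hence \<open>x\<close> and \<open>y\<close> see at most \<open>c\<close> and one of \<open>p, q\<close> beforehand, and \<open>a\<close> and \<open>b\<close> see only \<open>x, y\<close>, since \<open>m\<close> is reachable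
  only through \<open>a\<close> or \<open>b\<close>. This shows \<open>col_cg_G\<close>.

  Without \<open>cp\<close> the answer \<open>p\<close> to \<open>q\<close> is no longer legal after the opening \<open>c\<close>, and Breaker gets the
  initiative. A vertex with two marked neighbours and a third one that Breaker could mark next is a
  threat; Maker has to mark it at once. Whatever the opening, Breaker reaches one of the pairs
  \<open>ay\<close> (or \<open>by\<close>), \<open>cq\<close>, \<open>am\<close>, \<open>px\<close>, with Maker to move, and from each of them, after at most one
  further exchange of moves, everything that Maker can do leaves a threat. This is \<open>col_cg_H\<close>.

  Two general principles turn these analyses into proofs about strategies that depend on the whole
  history of the game: \<open>col_cg_le_of_responses\<close> for the upper bound, and \<open>no_threat\<close> for the lower
  bound, which says that a Maker who keeps to the bound never leaves Breaker a threat.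
\<close>

section \<open>Positions as sets\<close>

text \<open>
  Legality of a move and the back degree depend only on the set of marked vertices. Working with
  that set identifies the many histories that lead to the same situation.
\<close>

definition neighbours :: "'a pair_pre_digraph \<Rightarrow> 'a \<Rightarrow> 'a set" where
  "neighbours G v = {u. (u, v) \<in> parcs G}"

definition playable :: "'a pair_pre_digraph \<Rightarrow> 'a set \<Rightarrow> 'a \<Rightarrow> bool" where
  "playable G S v \<longleftrightarrow> v \<in> pverts G \<and> v \<notin> S \<and> (S = {} \<or> S \<inter> neighbours G v \<noteq> {})"

lemma legal_move_iff_playable: "legal_move G p v \<longleftrightarrow> playable G (set p) v"
  by (auto simp: legal_move_def playable_def neighbours_def)

lemma back_degree_eq: "back_degree G p v = card (set p \<inter> neighbours G v)"
  by (simp add: back_degree_def neighbours_def Int_def)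

section \<open>Bounding the number from above\<close>

text \<open>
  The family \<open>\<P>\<close> collects the positions with Breaker to move that Maker is prepared to face. Since
  Maker has an answer leading back into \<open>\<P>\<close> after each move of Breaker, choosing such an answer from
  the current set alone is a strategy that keeps to the bound for ever.
\<close>

lemma col_cg_le_of_responses:
  assumes k: "0 < k"
    and start: "s \<in> pverts G" "{s} \<in> \<P>"
    and degree: "\<And>S w. S \<in> \<P> \<Longrightarrow> playable G S w \<Longrightarrow> card (S \<inter> neighbours G w) < k"
    and response: "\<And>S w. S \<in> \<P> \<Longrightarrow> playable G S w \<Longrightarrow> insert w S \<noteq> pverts G \<Longrightarrow>
      \<exists>v. playable G (insert w S) v \<and> card (insert w S \<inter> neighbours G v) < k
        \<and> insert v (insert w S) \<in> \<P>"
  shows "col_cg G \<le> k"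
proof -
  define good where "good S v \<longleftrightarrow>
    playable G S v \<and> card (S \<inter> neighbours G v) < k \<and> insert v S \<in> \<P>" for S v
  define \<sigma> where "\<sigma> p = (SOME v. good (set p) v)" for p
  have reply: "good (set p) (\<sigma> p)" if "\<exists>v. good (set p) v" for p
    unfolding \<sigma>_def using that by (rule someI_ex)
  have first_move: "\<exists>v. good {} v"
    using k start by (auto simp: good_def playable_def)
  have maker_fine: "\<exists>v. good (set p) v"
    if "p = [] \<or> (\<exists>S\<in>\<P>. \<exists>w. playable G S w \<and> set p = insert w S)" "set p \<noteq> pverts G" for p
    using that first_move response unfolding good_def by (elim disjE bexE exE conjE) auto
  \<comment> \<open>Positions with Maker to move are described by the preceding one in \<open>\<P>\<close> and Breaker's move,
    which is the form in which the assumption on responses applies.\<close>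
  have inv: "if even (length p)
      then p = [] \<or> (\<exists>S\<in>\<P>. \<exists>w. playable G S w \<and> set p = insert w S)
      else set p \<in> \<P>" if "consistent G \<sigma> p" for p
    using that
  proof (induction rule: consistent.induct)
    case (maker p)
    then have "set p \<noteq> pverts G"
      by (auto simp: legal_move_iff_playable playable_def)
    with maker maker_fine[of p] reply[of p] show ?case
      by (auto simp: good_def)
  qed (auto simp: legal_move_iff_playable)
  have "maker_strategy G \<sigma>"
    unfolding maker_strategy_def
  proof (intro allI impI, elim conjE)
    fix p assume "consistent G \<sigma> p" "even (length p)" "set p \<noteq> pverts G"
    then show "legal_move G p (\<sigma> p)"
      using inv[of p] maker_fine[of p] reply[of p]
      by (simp add: good_def legal_move_iff_playable)
  qed
  moreover have "guarantees G \<sigma> k"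
    unfolding guarantees_def
  proof (intro allI impI)
    fix p v assume "consistent G \<sigma> (p @ [v])"
    then show "back_degree G p v < k"
    proof cases
      case maker
      then have "set p \<noteq> pverts G"
        by (auto simp: legal_move_iff_playable playable_def)
      with maker inv[of p] maker_fine[of p] reply[of p] show ?thesis
        by (auto simp: good_def back_degree_eq)
    next
      case breaker
      with inv[of p] degree[of "set p" v] show ?thesis
        by (auto simp: legal_move_iff_playable back_degree_eq)
    qed simp
  qed
  ultimately show ?thesis
    unfolding col_cg_def by (blast intro: Least_le)
qed

section \<open>Bounding the number from below\<close>

text \<open>
  Marking \<open>z\<close>, or having marked it, leaves \<open>v\<close> with \<open>k\<close> marked neighbours while \<open>v\<close> itself is still
  unmarked. Admitting \<open>z \<in> S\<close> covers vertices that are already beyond rescue.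
\<close>

definition threat :: "'a pair_pre_digraph \<Rightarrow> nat \<Rightarrow> 'a set \<Rightarrow> 'a \<Rightarrow> 'a \<Rightarrow> bool" where
  "threat G k S z v \<longleftrightarrow> (z \<in> S \<or> playable G S z) \<and>
     v \<in> pverts G \<and> v \<notin> insert z S \<and> k \<le> card (insert z S \<inter> neighbours G v)"

text \<open>
  For a lower bound one supposes that Maker can keep all back degrees below \<open>k\<close>, and follows a play
  from the empty position to a contradiction.
\<close>

locale maker_holds =
  fixes G :: "'a pair_pre_digraph" and \<sigma> :: "'a list \<Rightarrow> 'a" and k :: nat
  assumes pair_graph: "pair_graph G"
    and connected: "Digraph_Component.connected (with_proj G)"
    and strategy: "maker_strategy G \<sigma>"
    and guarantee: "guarantees G \<sigma> k"
begin

definition maker_turn :: "'a set \<Rightarrow> bool" where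
  "maker_turn S \<longleftrightarrow> (\<exists>p. consistent G \<sigma> p \<and> even (length p) \<and> set p = S)"

definition breaker_turn :: "'a set \<Rightarrow> bool" where
  "breaker_turn S \<longleftrightarrow> (\<exists>p. consistent G \<sigma> p \<and> odd (length p) \<and> set p = S)"

lemma finite_pverts: "finite (pverts G)"
proof -
  interpret pair_graph G by (rule pair_graph)
  show ?thesis by simp
qed

lemma start_maker_turn: "maker_turn {}"
  unfolding maker_turn_def by (intro exI[of _ "[]"]) (simp add: consistent.start)

lemma maker_moves:
  assumes "maker_turn S" "v \<in> pverts G" "v \<notin> S"
  shows "\<exists>w. playable G S w \<and> breaker_turn (insert w S)"
proof -
  from assms(1) obtain p where p: "consistent G \<sigma> p" "even (length p)" "set p = S"
    by (auto simp: maker_turn_def)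
  moreover from this assms(2,3) strategy have "legal_move G p (\<sigma> p)"
    unfolding maker_strategy_def by blast
  ultimately have "consistent G \<sigma> (p @ [\<sigma> p])" "odd (length (p @ [\<sigma> p]))"
    "set (p @ [\<sigma> p]) = insert (\<sigma> p) S" "playable G S (\<sigma> p)"
    by (auto intro: consistent.maker simp: legal_move_iff_playable)
  then show ?thesis unfolding breaker_turn_def by blast
qed

lemma breaker_moves:
  assumes "breaker_turn S" "playable G S v"
  shows "maker_turn (insert v S)"
proof -
  from assms(1) obtain p where p: "consistent G \<sigma> p" "odd (length p)" "set p = S"
    by (auto simp: breaker_turn_def)
  with assms(2) have "consistent G \<sigma> (p @ [v])"
    by (auto intro: consistent.breaker simp: legal_move_iff_playable)
  moreover from p have "even (length (p @ [v]))" "set (p @ [v]) = insert v S" by auto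
  ultimately show ?thesis unfolding maker_turn_def by blast
qed

text \<open>
  The guarantee speaks of vertices at the moment they are marked, but it constrains unmarked ones as
  well: the game goes on until \<open>v\<close> is marked, and by then its marked neighbours can only have become
  more numerous.
\<close>

lemma consistent_not_crowded:
  assumes "consistent G \<sigma> p" "v \<in> pverts G" "v \<notin> set p"
  shows "card (set p \<inter> neighbours G v) < k"
  using assms
proof (induction "card (pverts G - set p)" arbitrary: p rule: less_induct)
  case less
  have full: "set p \<noteq> pverts G" using less.prems by auto
  obtain w where w: "consistent G \<sigma> (p @ [w])" "legal_move G p w"
  proof (cases "even (length p)")
    case True
    with less.prems full strategy have "legal_move G p (\<sigma> p)"
      by (simp add: maker_strategy_def)
    with True less.prems that show thesis by (blast intro: consistent.maker)
  next
    case False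
    obtain w where "legal_move G p w"
      using exists_legal_move[OF pair_graph connected consistent_subset full] less.prems by blast
    with False less.prems that show thesis by (blast intro: consistent.breaker)
  qed
  show ?case
  proof (cases "w = v")
    case True
    with w guarantee show ?thesis by (auto simp: guarantees_def back_degree_eq)
  next
    case False
    from w(2) have "pverts G - set (p @ [w]) \<subset> pverts G - set p"
      by (auto simp: legal_move_def)
    then have "card (pverts G - set (p @ [w])) < card (pverts G - set p)"
      using finite_pverts by (simp add: psubset_card_mono)
    then have "card (set (p @ [w]) \<inter> neighbours G v) < k"
      using less.hyps[of "p @ [w]"] w(1) less.prems False by simp
    moreover have "card (set p \<inter> neighbours G v) \<le> card (set (p @ [w]) \<inter> neighbours G v)"
      by (rule card_mono) auto
    ultimately show ?thesis by simp
  qed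
qed

text \<open>
  Breaker would carry the threat out by marking \<open>z\<close>, unless that has happened already; either way an
  unmarked vertex has more marked neighbours than it can ever have.
\<close>

lemma no_threat:
  assumes "breaker_turn S"
  shows "\<not> threat G k S z v"
proof
  assume t: "threat G k S z v"
  obtain p where "consistent G \<sigma> p" "set p = insert z S"
    using t assms breaker_moves[of S z]
    by (auto simp: threat_def maker_turn_def breaker_turn_def insert_absorb)
  then have "card (insert z S \<inter> neighbours G v) < k"
    using t consistent_not_crowded[of p v] by (simp add: threat_def)
  with t show False by (simp add: threat_def)
qed

end

section \<open>The graph\<close>

lemma pair_graph_delete_edge:
  assumes "pair_graph G"
  shows "pair_graph (delete_edge G u v)"
proof -
  interpret pair_graph G by (rule assms)
  show ?thesis
    using in_arcsD1 in_arcsD2 pair_no_loops arcs_symmetric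
    by unfold_locales
      (auto simp: delete_edge_def symmetric_def sym_def arcs_ends_def arc_to_ends_def)
qed

lemma connectedI_root:
  assumes G: "pair_graph G" and r: "r \<in> pverts G"
    and reach: "\<And>v. v \<in> pverts G \<Longrightarrow> (r, v) \<in> (parcs G)\<^sup>*"
  shows "Digraph_Component.connected (with_proj G)"
proof -
  interpret pair_graph G by (rule G)
  let ?R = "rtrancl_on (pverts G) (parcs G)"
  have "(r, v) \<in> ?R" if "v \<in> pverts G" for v
    using reach[OF that]
  proof (induction rule: rtrancl_induct)
    case (step y z)
    then show ?case using in_arcsD2 by (blast intro: rtrancl_on_into_rtrancl_on)
  qed (use r in simp)
  moreover have sym: "sym (parcs G)" using arcs_symmetric by (auto simp: sym_def)
  ultimately have "(u, v) \<in> ?R" if "u \<in> pverts G" "v \<in> pverts G" for u v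
    using that rtrancl_on_sym[OF sym] by (meson rtrancl_on_trans symD)
  moreover have "parcs (mk_symmetric (with_proj G)) = parcs G"
    using arcs_symmetric by (auto simp: mk_symmetric_def)
  ultimately show ?thesis using r
    by (auto simp: Digraph_Component.connected_def strongly_connected_def reachable_def
      mk_symmetric_def)
qed

text \<open>
  Vertices with names keep the case analyses readable, where numerals would hide the symmetry
  exchanging \<open>a\<close> and \<open>b\<close>.
\<close>

locale eight_vertices =
  fixes a b c x y m p q :: 'a
  assumes distinct_vertices: "distinct [a, b, c, x, y, m, p, q]"
begin

lemma vertices_neq [simp]:
  "a \<noteq> b" "a \<noteq> c" "a \<noteq> x" "a \<noteq> y" "a \<noteq> m" "a \<noteq> p" "a \<noteq> q"
  "b \<noteq> c" "b \<noteq> x" "b \<noteq> y" "b \<noteq> m" "b \<noteq> p" "b \<noteq> q"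
  "c \<noteq> x" "c \<noteq> y" "c \<noteq> m" "c \<noteq> p" "c \<noteq> q"
  "x \<noteq> y" "x \<noteq> m" "x \<noteq> p" "x \<noteq> q"
  "y \<noteq> m" "y \<noteq> p" "y \<noteq> q" "m \<noteq> p" "m \<noteq> q" "p \<noteq> q"
  using distinct_vertices by auto

lemmas vertices_neq' [simp] = vertices_neq [symmetric]

definition edges :: "('a \<times> 'a) set" where
  "edges = {(a, x), (a, y), (a, m), (b, x), (b, y), (b, m), (c, x), (c, y),
    (p, x), (p, c), (q, y), (q, c)}"

definition G :: "'a pair_pre_digraph" where
  "G = \<lparr>pverts = {a, b, c, x, y, m, p, q}, parcs = edges \<union> edges\<inverse>\<rparr>"

definition H :: "'a pair_pre_digraph" where
  "H = delete_edge G c p"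

lemma pverts_G [simp]: "pverts G = {a, b, c, x, y, m, p, q}"
  by (simp add: G_def)

lemma pverts_H [simp]: "pverts H = {a, b, c, x, y, m, p, q}"
  by (simp add: H_def delete_edge_def)

lemma neighbours_G [simp]:
  "neighbours G a = {x, y, m}" "neighbours G b = {x, y, m}" "neighbours G c = {x, y, p, q}"
  "neighbours G x = {a, b, c, p}" "neighbours G y = {a, b, c, q}"
  "neighbours G m = {a, b}" "neighbours G p = {x, c}" "neighbours G q = {y, c}"
  by (auto simp: neighbours_def G_def edges_def)

lemma neighbours_H [simp]:
  "neighbours H a = {x, y, m}" "neighbours H b = {x, y, m}" "neighbours H c = {x, y, q}"
  "neighbours H x = {a, b, c, p}" "neighbours H y = {a, b, c, q}"
  "neighbours H m = {a, b}" "neighbours H p = {x}" "neighbours H q = {y, c}"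
  by (auto simp: neighbours_def H_def G_def edges_def delete_edge_def)

lemma pair_graph_G: "pair_graph G"
  by unfold_locales
    (auto simp: G_def edges_def symmetric_def sym_def arcs_ends_def arc_to_ends_def)

lemma cp_in_G: "(c, p) \<in> parcs G"
  by (simp add: G_def edges_def)

lemma pair_graph_H: "pair_graph H"
  unfolding H_def by (rule pair_graph_delete_edge[OF pair_graph_G])

lemma reachable_H:
  assumes "v \<in> pverts H"
  shows "(c, v) \<in> (parcs H)\<^sup>*"
proof -
  have arc: "(u, w) \<in> parcs H" if "u \<in> neighbours H w" for u w
    using that by (simp add: neighbours_def)
  have cx: "(c, x) \<in> (parcs H)\<^sup>*" and cy: "(c, y) \<in> (parcs H)\<^sup>*" and cq: "(c, q) \<in> (parcs H)\<^sup>*"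
    by (auto intro!: r_into_rtrancl arc)
  have xa: "(c, a) \<in> (parcs H)\<^sup>*" and xb: "(c, b) \<in> (parcs H)\<^sup>*" and xp: "(c, p) \<in> (parcs H)\<^sup>*"
    by (auto intro!: rtrancl_into_rtrancl[OF cx] arc)
  have am: "(c, m) \<in> (parcs H)\<^sup>*"
    by (auto intro!: rtrancl_into_rtrancl[OF xa] arc)
  show ?thesis using assms cx cy cq xa xb xp am by auto
qed

lemma connected_H: "Digraph_Component.connected (with_proj H)"
  by (rule connectedI_root[OF pair_graph_H _ reachable_H]) auto

lemma connected_G: "Digraph_Component.connected (with_proj G)"
proof (rule connectedI_root[OF pair_graph_G])
  have "parcs H \<subseteq> parcs G" by (auto simp: H_def delete_edge_def)
  then show "(c, v) \<in> (parcs G)\<^sup>*" if "v \<in> pverts G" for v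
    using that reachable_H[of v] rtrancl_mono[of "parcs H" "parcs G"] by auto
qed simp

section \<open>Maker's pairing strategy\<close>

text \<open>
  The pairing only breaks down when Breaker takes \<open>m\<close>, which is in no pair. By then \<open>a, b, c, x, y\<close> are
  marked and at most \<open>p, q\<close> remain, whose degree is 2, so any answer will do.
\<close>

lemma col_cg_G: "col_cg G \<le> 3"
proof -
  define \<P> where "\<P> = {{c}, {c, p, q}, {c, x, y}, {c, x, y, p, q}, {c, x, y, a, b},
    {c, x, y, a, b, p, q}, {c, x, y, a, b, m, p}}"
  show ?thesis
  proof (rule col_cg_le_of_responses[where s = c and \<P> = \<P>])
    fix S w assume S: "S \<in> \<P>" and w: "playable G S w"
    show "card (S \<inter> neighbours G w) < 3"
      using S w by (auto simp: \<P>_def playable_def)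
    \<comment> \<open>Only \<open>m\<close> has no natural partner; answering it by \<open>p\<close> accounts for the last set in \<open>\<P>\<close>.\<close>
    define mate where "mate = id(a := b, b := a, x := y, y := x, p := q, q := p, m := p)"
    assume "insert w S \<noteq> pverts G"
    moreover have "w \<in> {a, b, c, x, y, m, p, q}"
      using w by (simp add: playable_def)
    ultimately have "playable G (insert w S) (mate w)
        \<and> card (insert w S \<inter> neighbours G (mate w)) < 3 \<and> insert (mate w) (insert w S) \<in> \<P>"
      using S w unfolding \<P>_def
      by (elim insertE emptyE) (simp_all add: playable_def mate_def insert_commute)
    then show "\<exists>v. playable G (insert w S) v \<and> card (insert w S \<inter> neighbours G v) < 3
        \<and> insert v (insert w S) \<in> \<P>" by blast
  qed (auto simp: \<P>_def)
qed

section \<open>Breaker's threats without the edge\<close>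

text \<open>
  Each position below is lost for Maker. In a fact \<open>threat H 3 S z v\<close> the first element of \<open>S\<close>
  is Maker's last move, and the fact refutes that move: Breaker marks \<open>z\<close> and \<open>v\<close> gets a third marked
  neighbour, or has it already.
\<close>

lemma col_cg_H: "3 < col_cg H"
proof (rule ccontr)
  assume "\<not> 3 < col_cg H"
  moreover obtain \<sigma> where \<sigma>: "maker_strategy H \<sigma>" "guarantees H \<sigma> (col_cg H)"
    using col_cg_attained[OF pair_graph_H connected_H] by blast
  ultimately have "guarantees H \<sigma> 3"
    unfolding guarantees_def by (meson linorder_not_less order_less_le_trans)
  then interpret maker_holds H \<sigma> 3
    using pair_graph_H connected_H \<sigma>(1) by (intro maker_holds.intro)
  \<comment> \<open>After \<open>a, y\<close> every move of Maker creates a threat; by symmetry the same holds after \<open>b, y\<close>.\<close>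
  have ay: False if S: "maker_turn {a', y}" and a': "a' = a \<and> b' = b \<or> a' = b \<and> b' = a" for a' b'
  proof -
    obtain w where w: "playable H {a', y} w" "breaker_turn {w, a', y}"
      using maker_moves[OF S, of c] a' by auto
    then have "w \<in> {b', c, x, m, q}" using a' by (auto simp: playable_def)
    moreover have "threat H 3 {b', a', y} c x" "threat H 3 {c, a', y} b' x"
      "threat H 3 {x, a', y} m b'" "threat H 3 {m, a', y} x b'" "threat H 3 {q, a', y} x c"
      using a' by (auto simp: threat_def playable_def)
    ultimately show False using w(2) no_threat by blast
  qed
  \<comment> \<open>Only \<open>x\<close> and \<open>y\<close> are within reach, and \<open>x\<close> would make \<open>a\<close> available as the third marked
    neighbour of \<open>y\<close>. After Breaker's \<open>a\<close>, the vertex \<open>x\<close> is attacked from \<open>b\<close>, and marking it exposes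
    \<open>b\<close> to \<open>m\<close>. With the edge \<open>cp\<close>, Maker could have answered \<open>q\<close> by \<open>p\<close>.\<close>
  have cq: False if S: "maker_turn {q, c}"
  proof -
    obtain w where w: "playable H {q, c} w" "breaker_turn {w, q, c}"
      using maker_moves[OF S, of a] by auto
    then have "w \<in> {x, y}" by (auto simp: playable_def)
    moreover have "threat H 3 {x, q, c} a y"
      by (simp add: threat_def playable_def)
    ultimately have "breaker_turn {y, q, c}" using w(2) no_threat by blast
    then have S': "maker_turn {a, y, q, c}"
      by (rule breaker_moves) (simp add: playable_def)
    obtain w where w: "playable H {a, y, q, c} w" "breaker_turn {w, a, y, q, c}"
      using maker_moves[OF S', of b] by auto
    then have "w \<in> {b, x, m}" by (auto simp: playable_def)
    moreover have "threat H 3 {b, a, y, q, c} a x" "threat H 3 {x, a, y, q, c} m b"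
      "threat H 3 {m, a, y, q, c} b x"
      by (simp_all add: threat_def playable_def)
    ultimately show False using w(2) no_threat by blast
  qed
  \<comment> \<open>Maker has to take \<open>b\<close>, as \<open>x\<close> or \<open>y\<close> would give \<open>b\<close> its second marked neighbour. After Breaker's
    \<open>x\<close>, the vertex \<open>y\<close> sees \<open>a, b\<close> and is attacked from \<open>c\<close>; marking it exposes \<open>c\<close> to \<open>q\<close>.\<close>
  have am: False if S: "maker_turn {a, m}"
  proof -
    obtain w where w: "playable H {a, m} w" "breaker_turn {w, a, m}"
      using maker_moves[OF S, of b] by auto
    then have "w \<in> {b, x, y}" by (auto simp: playable_def)
    moreover have "threat H 3 {x, a, m} y b" "threat H 3 {y, a, m} x b"
      by (simp_all add: threat_def playable_def)
    ultimately have "breaker_turn {b, a, m}" using w(2) no_threat by blast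
    then have S': "maker_turn {x, b, a, m}"
      by (rule breaker_moves) (simp add: playable_def)
    obtain w where w: "playable H {x, b, a, m} w" "breaker_turn {w, x, b, a, m}"
      using maker_moves[OF S', of c] by auto
    then have "w \<in> {c, y, p}" by (auto simp: playable_def)
    moreover have "threat H 3 {c, x, b, a, m} q y" "threat H 3 {y, x, b, a, m} q c"
      "threat H 3 {p, x, b, a, m} c y"
      by (simp_all add: threat_def playable_def)
    ultimately show False using w(2) no_threat by blast
  qed
  \<comment> \<open>Breaker aims to have both \<open>c\<close> and one of \<open>a, b\<close> marked next to \<open>p, x\<close>: then \<open>y\<close> is attacked, and
    marking it exposes the other of \<open>a, b\<close> to \<open>m\<close>. Maker's move supplies one of the two
    ingredients and Breaker adds the other.\<close>
  have acpx: False
    if S: "maker_turn {a', c, p, x}" and a': "a' = a \<and> b' = b \<or> a' = b \<and> b' = a" for a' b'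
  proof -
    obtain w where w: "playable H {a', c, p, x} w" "breaker_turn {w, a', c, p, x}"
      using maker_moves[OF S, of y] a' by auto
    then have "w \<in> {b', y, m, q}" using a' by (auto simp: playable_def)
    moreover have "threat H 3 {b', a', c, p, x} q y" "threat H 3 {y, a', c, p, x} m b'"
      "threat H 3 {m, a', c, p, x} b' y" "threat H 3 {q, a', c, p, x} b' y"
      using a' by (auto simp: threat_def playable_def)
    ultimately show False using w(2) no_threat by blast
  qed
  have px: False if S: "maker_turn {p, x}"
  proof -
    obtain w where w: "playable H {p, x} w" "breaker_turn {w, p, x}"
      using maker_moves[OF S, of a] by auto
    then consider "w = a" | "w = b" | "w = c" by (auto simp: playable_def)
    then show False
    proof cases
      case 1
      then have "maker_turn {a, c, p, x}"
        using breaker_moves[OF w(2), of c] by (simp add: playable_def insert_commute)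
      then show False using acpx[of a b] by simp
    next
      case 2
      then have "maker_turn {b, c, p, x}"
        using breaker_moves[OF w(2), of c] by (simp add: playable_def insert_commute)
      then show False using acpx[of b a] by simp
    next
      case 3
      then show False
        using breaker_moves[OF w(2), of a] acpx[of a b] by (simp add: playable_def)
    qed
  qed
  obtain w where w: "playable H {} w" "breaker_turn {w}"
    using maker_moves[OF start_maker_turn, of a] by auto
  then consider "w = a" | "w = b" | "w = c" | "w = x" | "w = y" | "w = m" | "w = p" | "w = q"
    by (auto simp: playable_def)
  then show False
  proof cases
    case 1
    then have "maker_turn {a, y}"
      using breaker_moves[OF w(2), of y] by (simp add: playable_def insert_commute)
    then show False using ay[of a b] by simp
  next
    case 2
    then have "maker_turn {b, y}"
      using breaker_moves[OF w(2), of y] by (simp add: playable_def insert_commute)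
    then show False using ay[of b a] by simp
  next
    case 3
    then show False using breaker_moves[OF w(2), of q] cq by (simp add: playable_def)
  next
    case 4
    then show False using breaker_moves[OF w(2), of p] px by (simp add: playable_def)
  next
    case 5
    then show False using breaker_moves[OF w(2), of a] ay[of a b] by (simp add: playable_def)
  next
    case 6
    then show False using breaker_moves[OF w(2), of a] am by (simp add: playable_def)
  next
    case 7
    then have "maker_turn {p, x}"
      using breaker_moves[OF w(2), of x] by (simp add: playable_def insert_commute)
    then show False by (rule px)
  next
    case 8
    then have "maker_turn {q, c}"
      using breaker_moves[OF w(2), of c] by (simp add: playable_def insert_commute)
    then show False by (rule cq)
  qed
qed

end

theorem theorem4p2:
  shows "\<exists>(G :: nat pair_pre_digraph) u v.
    pair_graph G \<and> Digraph_Component.connected (with_proj G) \<and> (u, v) \<in> parcs G \<and>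
    Digraph_Component.connected (with_proj (delete_edge G u v)) \<and>
    col_cg (delete_edge G u v) > col_cg G"
proof -
  interpret eight_vertices "0 :: nat" 1 2 3 4 5 6 7
    by unfold_locales simp
  show ?thesis
    using pair_graph_G connected_G cp_in_G connected_H col_cg_G col_cg_H
    unfolding H_def by (meson order_le_less_trans)
qed

end
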